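(* Fix a constant $C>0$. For each $N$ let $g\sim\mathcal N(0,I_N)$, and let $\mathcal A=\mathcal A_N:(g,\omega)\mapsto \mathcal A(g,\omega)\in\Sigma_N$ be a randomized algorithm with $\mathbf E\|\mathcal A(g,\omega)\|^2\le CN$. Let $E=E_N$ and $D=D_N\ge 0$ be sequences, and suppose that $\mathcal A$ satisfies the following stability estimate with degree $D$: for all $\varepsilon\in[0,1]$ and all $\eta>0$, if $(g,g')$ is a $(1-\varepsilon)$-correlated pair of standard Normal vectors in $\mathbf R^N$, independent of $\omega$, then $$\mathbf P\big(\|\mathcal A(g,\omega)-\mathcal A(g',\omega)\|\ge 2\sqrt{\eta N}\big)\le \frac{CD\varepsilon}{2\eta}.$$ Assume $\omega(\log N)\le E\le N$ (i.e. $E/\log N\to\infty$ and $E\le N$) and $D\le o(2^{E/4})$ as $N\to\infty$. Then $$\mathbf P(\mathcal A(g,\omega)\in S(E;g))=o(1)\quad\text{as }N\to\infty.$$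
   Context: $\Sigma_N=\{\pm1\}^N$, and $\|\cdot\|$ is the Euclidean norm on $\mathbf R^N$. For $g\in\mathbf R^N$ (an instance of the number partitioning problem) and $E\in\mathbf R$, the solution set is $S(E;g)=\{x\in\Sigma_N:|\langle g,x\rangle|\le 2^{-E}\}$. A randomized algorithm is a measurable function $\mathcal A:(g,\omega)\mapsto x\in\Sigma_N$, where $\omega$ is a random variable in some Polish space $\Omega_N$, independent of the instance. For $p\in[0,1]$, a pair $(g,g')$ of $N$-dimensional standard Normal vectors is $p$-correlated if $g'=pg+\sqrt{1-p^2}\,\tilde g$, where $\tilde g$ is an independent copy of $g$. *)

theory Defs
  imports "HOL-Probability.Probability" "HOL-Library.Landau_Symbols"
begin

text \<open>
  The dimension \<open>N\<close> varies, so vectors of $\mathbf{R}^N$ are functions \<open>nat \<Rightarrow> real\<close> that are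
  extensional on \<open>{..<N}\<close>. On these, \<open>L2_set x {..<N}\<close> is the Euclidean norm.
\<close>

definition hypercube :: "nat \<Rightarrow> (nat \<Rightarrow> real) set" where
  "hypercube N = {..<N} \<rightarrow>\<^sub>E {-1, 1}"

definition inner_prod :: "nat \<Rightarrow> (nat \<Rightarrow> real) \<Rightarrow> (nat \<Rightarrow> real) \<Rightarrow> real" where
  "inner_prod N g x = (\<Sum>i<N. g i * x i)"

definition euclid_norm :: "nat \<Rightarrow> (nat \<Rightarrow> real) \<Rightarrow> real" where
  "euclid_norm N x = L2_set x {..<N}"

definition solution_set :: "nat \<Rightarrow> real \<Rightarrow> (nat \<Rightarrow> real) \<Rightarrow> (nat \<Rightarrow> real) set" where
  "solution_set N E g = {x \<in> hypercube N. \<bar>inner_prod N g x\<bar> \<le> 2 powr (- E)}"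

definition std_gaussian :: "nat \<Rightarrow> (nat \<Rightarrow> real) measure" where
  "std_gaussian N = (\<Pi>\<^sub>M i\<in>{..<N}. density lborel (\<lambda>t. ennreal (std_normal_density t)))"

text \<open>The joint law of a \<open>p\<close>-correlated pair $(g, pg + \sqrt{1-p^2}\,\tilde g)$.\<close>

definition correlated_gaussian_pair ::
  "nat \<Rightarrow> real \<Rightarrow> ((nat \<Rightarrow> real) \<times> (nat \<Rightarrow> real)) measure" where
  "correlated_gaussian_pair N p =
     distr (std_gaussian N \<Otimes>\<^sub>M std_gaussian N)
           (PiM {..<N} (\<lambda>_. borel) \<Otimes>\<^sub>M PiM {..<N} (\<lambda>_. borel))
           (\<lambda>(g, h). (g, \<lambda>i\<in>{..<N}. p * g i + sqrt (1 - p\<^sup>2) * h i))"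

definition polish_topology :: "'w topology \<Rightarrow> bool" where
  "polish_topology T \<longleftrightarrow> completely_metrizable_space T \<and> separable_space T"

text \<open>A probability law on the Borel sets of a Polish space: the law of a random variable
  with values in that space.\<close>

definition polish_law :: "'w topology \<Rightarrow> 'w measure \<Rightarrow> bool" where
  "polish_law T Q \<longleftrightarrow>
     polish_topology T \<and> prob_space Q \<and> space Q = topspace T \<and>
     sets Q = sigma_sets (topspace T) {U. openin T U}"

text \<open>
  The seed \<open>\<omega>\<close> with law \<open>Q\<close> is independent of the instance, so the joint law of the instance
  and the seed is a product measure.
\<close>

definition randomized_algorithm ::
  "nat \<Rightarrow> 'w topology \<Rightarrow> 'w measure \<Rightarrow> ((nat \<Rightarrow> real) \<times> 'w \<Rightarrow> (nat \<Rightarrow> real)) \<Rightarrow> bool" where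
  "randomized_algorithm N T Q A \<longleftrightarrow>
     polish_law T Q \<and>
     A \<in> (PiM {..<N} (\<lambda>_. borel) \<Otimes>\<^sub>M Q) \<rightarrow>\<^sub>M count_space (hypercube N)"

definition stable_with_degree ::
  "nat \<Rightarrow> real \<Rightarrow> real \<Rightarrow> 'w measure \<Rightarrow> ((nat \<Rightarrow> real) \<times> 'w \<Rightarrow> (nat \<Rightarrow> real)) \<Rightarrow> bool" where
  "stable_with_degree N C D Q A \<longleftrightarrow>
     (\<forall>\<epsilon>\<in>{0..1}. \<forall>\<eta>>0.
        \<P>(((g, g'), w) in correlated_gaussian_pair N (1 - \<epsilon>) \<Otimes>\<^sub>M Q.
           euclid_norm N (\<lambda>i. A (g, w) i - A (g', w) i) \<ge> 2 * sqrt (\<eta> * real N))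
        \<le> C * D * \<epsilon> / (2 * \<eta>))"

lemma sets_std_gaussian [measurable_cong]:
  "sets (std_gaussian N) = sets (PiM {..<N} (\<lambda>_. borel))"
  unfolding std_gaussian_def by (intro sets_PiM_cong) auto

lemma sets_correlated_gaussian_pair [measurable_cong]:
  "sets (correlated_gaussian_pair N p) =
     sets (PiM {..<N} (\<lambda>_. borel) \<Otimes>\<^sub>M PiM {..<N} (\<lambda>_. borel))"
  unfolding correlated_gaussian_pair_def by simp

lemma prob_space_std_gaussian: "prob_space (std_gaussian N)"
  unfolding std_gaussian_def
  by (intro prob_space_PiM prob_space_normal_density) auto

lemma prob_space_correlated_gaussian_pair: "prob_space (correlated_gaussian_pair N p)"
proof -
  interpret pair_prob_space "std_gaussian N" "std_gaussian N"
    by (simp add: pair_prob_space_def pair_sigma_finite_def prob_space_std_gaussian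
        prob_space_imp_sigma_finite)
  show ?thesis
    unfolding correlated_gaussian_pair_def by (intro prob_space_distr) measurable
qed

end

theory Submission
  imports Defs "HOL-Real_Asymp.Real_Asymp"
begin

text \<open>
  Let \<open>g'\<close> be \<open>(1 - \<epsilon>)\<close>-correlated with \<open>g\<close>. Distinct points of the cube are at distance at least 2,
  so stability with \<open>\<eta> = 1 / N\<close> gives \<open>A(g, \<omega>) = A(g', \<omega>)\<close> except with probability at most
  \<open>C D \<epsilon> N / 2\<close>. On the other hand, given \<open>g\<close> and \<open>\<omega>\<close>, the vector \<open>A(g, \<omega>)\<close> is fixed and its inner
  product with \<open>g'\<close> is normal of variance at least \<open>\<epsilon> N\<close>, so \<open>A(g, \<omega>)\<close> solves \<open>g'\<close> with probability
  \<open>O(2 powr (- E) / sqrt (\<epsilon> N))\<close>. As \<open>g'\<close> has the law of \<open>g\<close>, the success probability is at most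
  the sum of the two bounds, and \<open>\<epsilon> = 2 powr (- E / 4) / N\<close> makes both tend to 0.
\<close>

section \<open>Rotation invariance of the Gaussian law\<close>

abbreviation std_normal :: "real measure" where
  "std_normal \<equiv> density lborel (\<lambda>t. ennreal (std_normal_density t))"

lemma prob_space_std_normal: "prob_space std_normal"
  by (rule prob_space_normal_density) simp

lemma product_prob_space_std_normal: "product_prob_space (\<lambda>_. std_normal)"
  by (intro product_prob_space.intro product_sigma_finite.intro product_prob_space_axioms.intro
      prob_space_imp_sigma_finite prob_space_std_normal)

text \<open>Scaled independent normals add to a normal whose variance is the sum
  \<open>p\<^sup>2 + q\<^sup>2\<close>. Positivity of \<open>p\<close> and \<open>q\<close> keeps
  both summands nondegenerate, so that each has a normal density.\<close>

lemma std_normal_rotate: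
  assumes pq: "p > 0" "q > 0" "p\<^sup>2 + q\<^sup>2 = 1"
  shows "distr (std_normal \<Otimes>\<^sub>M std_normal) lborel (\<lambda>(x, y). p * x + q * y) = std_normal"
proof -
  let ?M = "std_normal \<Otimes>\<^sub>M std_normal"
  interpret pair_prob_space std_normal std_normal
    by (simp add: pair_prob_space_def pair_sigma_finite_def prob_space_std_normal
        prob_space_imp_sigma_finite)
  have fst_distr: "distr ?M lborel fst = std_normal"
    using prob_space.distr_pair_fst[OF prob_space_std_normal, of std_normal] by (simp cong: distr_cong)
  have snd_distr: "distr ?M lborel snd = std_normal"
  proof -
    have "distr ?M lborel snd = distr (distr ?M (std_normal \<Otimes>\<^sub>M std_normal) (\<lambda>(x, y). (y, x))) lborel fst"
      by (subst distr_distr) (auto simp: comp_def case_prod_unfold)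
    also have "distr ?M (std_normal \<Otimes>\<^sub>M std_normal) (\<lambda>(x, y). (y, x)) = ?M"
      by (rule distr_pair_swap[symmetric])
    finally show ?thesis using fst_distr by simp
  qed
  have X: "distributed ?M lborel fst (normal_density 0 1)"
    by (auto simp: distributed_def fst_distr)
  have Y: "distributed ?M lborel snd (normal_density 0 1)"
    by (auto simp: distributed_def snd_distr)
  have "indep_var lborel fst lborel snd"
    unfolding indep_var_distribution_eq fst_distr snd_distr
  proof (intro conjI)
    \<comment> \<open>The two projections together form the identity map, so their joint law is the
      product measure itself.\<close>
    have "distr ?M (lborel \<Otimes>\<^sub>M lborel) (\<lambda>x. (fst x, snd x)) = distr ?M ?M (\<lambda>x. x)"
      by (rule distr_cong) (auto intro!: sets_pair_measure_cong)
    then show "?M = distr ?M (lborel \<Otimes>\<^sub>M lborel) (\<lambda>x. (fst x, snd x))" by simp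
  qed simp_all
  \<comment> \<open>The summands \<open>0\<close> give the shape that
    \<open>normal_density_affine\<close> produces.\<close>
  then have "indep_var borel ((\<lambda>x. 0 + p * x) \<circ> fst) borel ((\<lambda>x. 0 + q * x) \<circ> snd)"
    by (rule indep_var_compose) auto
  then have ind: "indep_var borel (\<lambda>z. 0 + p * fst z) borel (\<lambda>z. 0 + q * snd z)"
    by (simp add: comp_def)
  have "distributed ?M lborel (\<lambda>z. (0 + p * fst z) + (0 + q * snd z))
      (normal_density ((0 + p * 0) + (0 + q * 0)) (sqrt ((\<bar>p\<bar> * 1)\<^sup>2 + (\<bar>q\<bar> * 1)\<^sup>2)))"
    using pq by (intro add_indep_normal ind normal_density_affine X Y) auto
  then show ?thesis
    using pq by (simp add: distributed_def case_prod_unfold)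
qed

text \<open>The coordinates of the combined vector come from disjoint pairs of independent
  variables, so on boxes the claim factors into copies of the one-dimensional one. This is what
  makes the second member of a correlated pair a standard Gaussian vector.\<close>

lemma std_gaussian_rotate:
  assumes pq: "p > 0" "q > 0" "p\<^sup>2 + q\<^sup>2 = 1"
  shows "distr (std_gaussian N \<Otimes>\<^sub>M std_gaussian N) (PiM {..<N} (\<lambda>_. borel))
           (\<lambda>(g, h). \<lambda>i\<in>{..<N}. p * g i + q * h i) = std_gaussian N"
    (is "distr _ _ ?f = _")
proof -
  let ?G = "std_gaussian N"
  interpret P: product_prob_space "\<lambda>_. std_normal" "{..<N}"
    by (rule product_prob_space_std_normal)
  interpret G: prob_space ?G by (rule prob_space_std_gaussian)
  have f[measurable]: "?f \<in> ?G \<Otimes>\<^sub>M ?G \<rightarrow>\<^sub>M PiM {..<N} (\<lambda>_. borel)" by measurable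
  have "distr (?G \<Otimes>\<^sub>M ?G) (PiM {..<N} (\<lambda>_. borel)) ?f = PiM {..<N} (\<lambda>_. std_normal)"
  proof (rule P.PiM_eqI)
    show "sets (distr (?G \<Otimes>\<^sub>M ?G) (PiM {..<N} (\<lambda>_. borel)) ?f) = sets (PiM {..<N} (\<lambda>_. std_normal))"
      by (simp, intro sets_PiM_cong) auto
  next
    fix A :: "nat \<Rightarrow> real set" assume A: "\<And>i. i \<in> {..<N} \<Longrightarrow> A i \<in> sets std_normal"
    \<comment> \<open>The sets \<open>A i\<close> are known to be measurable only for
      \<open>i < N\<close>; filling up with the empty set makes \<open>B i\<close> measurable for
      every \<open>i\<close>.\<close>
    define B where "B i = (if i < N then A i else {})" for i
    have B[measurable]: "B i \<in> sets borel" for i using A by (auto simp: B_def)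
    have BA: "Pi\<^sub>E {..<N} A = Pi\<^sub>E {..<N} B" by (auto simp: B_def intro!: PiE_cong)
    have ind: "(indicator (Pi\<^sub>E {..<N} B) (?f z) :: ennreal) =
        (case z of (g, h) \<Rightarrow>\<Prod>i<N. indicator (B i) (p * g i + q * h i))" for z :: "(nat \<Rightarrow> real) \<times> (nat \<Rightarrow> real)" 
      by (cases z) (auto simp: indicator_def PiE_iff)
    have "emeasure (distr (?G \<Otimes>\<^sub>M ?G) (PiM {..<N} (\<lambda>_. borel)) ?f) (Pi\<^sub>E {..<N} B)
        = (\<integral>\<^sup>+z. indicator (Pi\<^sub>E {..<N} B) z \<partial>distr (?G \<Otimes>\<^sub>M ?G) (PiM {..<N} (\<lambda>_. borel)) ?f)"
      by (subst nn_integral_indicator) (auto intro!: sets_PiM_I_finite)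
    also have "\<dots> = (\<integral>\<^sup>+z. indicator (Pi\<^sub>E {..<N} B) (?f z) \<partial>(?G \<Otimes>\<^sub>M ?G))"
      by (subst nn_integral_distr) (auto intro!: sets_PiM_I_finite borel_measurable_indicator f)
    also have "\<dots> = (\<integral>\<^sup>+(g, h). (\<Prod>i<N. indicator (B i) (p * g i + q * h i)) \<partial>(?G \<Otimes>\<^sub>M ?G))"
      unfolding ind ..
    also have "\<dots> = (\<integral>\<^sup>+g. \<integral>\<^sup>+h. (\<Prod>i<N. indicator (B i) (p * g i + q * h i)) \<partial>?G \<partial>?G)"
      by (subst G.nn_integral_fst[symmetric]) (auto simp: case_prod_unfold)
    \<comment> \<open>For fixed \<open>g\<close> the integrand is a product of functions of single
      coordinates of \<open>h\<close>; the next step factors over the coordinates of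
      \<open>g\<close> in the same way.\<close>
    also have "\<dots> = (\<integral>\<^sup>+g. (\<Prod>i<N. \<integral>\<^sup>+y. indicator (B i) (p * g i + q * y) \<partial>std_normal) \<partial>?G)"
      unfolding std_gaussian_def
      by (intro nn_integral_cong P.product_nn_integral_prod) auto
    also have "\<dots> = (\<Prod>i<N. \<integral>\<^sup>+x. \<integral>\<^sup>+y. indicator (B i) (p * x + q * y) \<partial>std_normal \<partial>std_normal)"
      unfolding std_gaussian_def
      by (intro P.product_nn_integral_prod) auto
    also have "\<dots> = (\<Prod>i<N. \<integral>\<^sup>+z. indicator (B i) (p * fst z + q * snd z) \<partial>(std_normal \<Otimes>\<^sub>M std_normal))"
      by (subst sigma_finite_measure.nn_integral_fst[OF prob_space_imp_sigma_finite[OF prob_space_std_normal], symmetric]) auto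
    also have "\<dots> = (\<Prod>i<N. \<integral>\<^sup>+z. indicator (B i) z
        \<partial>distr (std_normal \<Otimes>\<^sub>M std_normal) lborel (\<lambda>(x, y). p * x + q * y))"
      by (subst nn_integral_distr) (auto simp: case_prod_unfold)
    also have "\<dots> = (\<Prod>i<N. emeasure std_normal (B i))"
      unfolding std_normal_rotate[OF pq] by (simp add: nn_integral_indicator)
    finally show "emeasure (distr (?G \<Otimes>\<^sub>M ?G) (PiM {..<N} (\<lambda>_. borel)) ?f) (Pi\<^sub>E {..<N} A)
        = (\<Prod>i<N. emeasure std_normal (A i))"
      unfolding BA by (simp add: B_def)
  qed auto
  then show ?thesis by (simp only: std_gaussian_def)
qed

section \<open>Anticoncentration of the inner product\<close>

lemma (in prob_space) normal_interval_le:
  assumes X: "distributed M lborel X (normal_density \<mu> \<sigma>)" and "\<sigma> > 0"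
  shows "emeasure M {z \<in> space M. X z \<in> {a..b}} \<le> ennreal ((b - a) / (sqrt (2 * pi) * \<sigma>))"
proof (cases "a \<le> b")
  case True
  have "{z \<in> space M. X z \<in> {a..b}} = X -` {a..b} \<inter> space M" by auto
  then have "emeasure M {z \<in> space M. X z \<in> {a..b}}
      = (\<integral>\<^sup>+x. ennreal (normal_density \<mu> \<sigma> x) * indicator {a..b} x \<partial>lborel)"
    using distributed_emeasure[OF X, of "{a..b}"] by simp
  \<comment> \<open>The exponential factor is at most 1, so the density never exceeds its peak
    value.\<close>
  also have "\<dots> \<le> (\<integral>\<^sup>+x. ennreal (1 / (sqrt (2 * pi) * \<sigma>)) * indicator {a..b} x \<partial>lborel)"
  proof (intro nn_integral_mono mult_right_mono ennreal_leI)
    fix x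
    have "normal_density \<mu> \<sigma> x \<le> 1 / sqrt (2 * pi * \<sigma>\<^sup>2) * 1"
      unfolding normal_density_def by (intro mult_left_mono) auto
    then show "normal_density \<mu> \<sigma> x \<le> 1 / (sqrt (2 * pi) * \<sigma>)"
      using \<open>\<sigma> > 0\<close> by (simp add: real_sqrt_mult)
  qed auto
  also have "\<dots> = ennreal ((b - a) / (sqrt (2 * pi) * \<sigma>))"
    using True \<open>\<sigma> > 0\<close> by (simp add: nn_integral_cmult_indicator ennreal_mult[symmetric])
  finally show ?thesis .
qed simp

text \<open>Each term is a standard normal multiplied by a sign, and the terms are independent, so
  the variances add up to \<open>N\<close> whichever \<open>x\<close> is taken.\<close>

lemma inner_prod_hypercube_normal:
  assumes x: "x \<in> hypercube N" and "N \<ge> 1"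
  shows "distributed (std_gaussian N) lborel (\<lambda>h. inner_prod N h x) (normal_density 0 (sqrt (real N)))"
proof -
  let ?G = "std_gaussian N"
  interpret P: product_prob_space "\<lambda>_. std_normal" "{..<N}"
    by (rule product_prob_space_std_normal)
  interpret G: prob_space ?G by (rule prob_space_std_gaussian)
  have ne: "{..<N} \<noteq> {}" using \<open>N \<ge> 1\<close> by (force simp: lessThan_def)
  have x1: "x i = -1 \<or> x i = 1" if "i < N" for i
    using x that by (auto simp: hypercube_def PiE_iff)
  then have x0: "x i \<noteq> 0" if "i < N" for i using that by force
  have comp: "distr ?G borel (\<lambda>h. h i) = std_normal" if "i < N" for i
  proof -
    have "distr ?G borel (\<lambda>h. h i) = distr ?G std_normal (\<lambda>h. h i)"
      by (rule distr_cong) auto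
    also have "\<dots> = std_normal"
      unfolding std_gaussian_def using that prob_space_std_normal by (intro distr_PiM_component) auto
    finally show ?thesis .
  qed
  \<comment> \<open>The joint law of all coordinates is \<open>std_gaussian N\<close>, which is by
    definition the product of the marginals.\<close>
  have "G.indep_vars (\<lambda>_. borel) (\<lambda>i h. h i) {..<N}"
  proof (subst G.indep_vars_iff_distr_eq_PiM')
    have "distr ?G (PiM {..<N} (\<lambda>_. borel)) (\<lambda>h. \<lambda>i\<in>{..<N}. h i) = distr ?G ?G (\<lambda>h. h)"
      by (intro distr_cong) (simp_all add: sets_std_gaussian, simp add: std_gaussian_def space_PiM)
    also have "\<dots> = PiM {..<N} (\<lambda>i. distr ?G borel (\<lambda>h. h i))"
    proof -
      have "PiM {..<N} (\<lambda>i. distr ?G borel (\<lambda>h. h i)) = ?G"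
        by (subst (2) std_gaussian_def) (intro PiM_cong refl, simp add: comp)
      then show ?thesis by simp
    qed
    finally show "distr ?G (PiM {..<N} (\<lambda>_. borel)) (\<lambda>h. \<lambda>i\<in>{..<N}. h i)
        = PiM {..<N} (\<lambda>i. distr ?G borel (\<lambda>h. h i))" .
  qed (use ne in auto)
  then have ind: "G.indep_vars (\<lambda>_. borel) (\<lambda>i h. 0 + x i * h i) {..<N}"
    by (rule G.indep_vars_compose2) auto
  have "distributed ?G lborel (\<lambda>h. \<Sum>i<N. 0 + x i * h i)
      (normal_density (\<Sum>i<N. 0 + x i * 0) (sqrt (\<Sum>i<N. (\<bar>x i\<bar> * 1)\<^sup>2)))"
  proof (intro G.sum_indep_normal ind G.normal_density_affine)
    fix i assume "i \<in> {..<N}"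
    then have "distr ?G lborel (\<lambda>h. h i) = std_normal"
      using comp[of i] by (simp cong: distr_cong)
    then show "distributed ?G lborel (\<lambda>h. h i) (normal_density 0 1)"
      using \<open>i \<in> _\<close> by (auto simp: distributed_def)
    qed (use x0 ne in auto)
  moreover have "(\<Sum>i<N. (\<bar>x i\<bar> * 1)\<^sup>2) = real N"
  proof -
    have "(\<bar>x i\<bar> * 1)\<^sup>2 = 1" if "i < N" for i using x1[OF that] by auto
    then show ?thesis by simp
  qed
  ultimately show ?thesis
    by (simp add: inner_prod_def mult.commute)
qed


lemma inner_prod_restrict [simp]: "inner_prod N (restrict g {..<N}) x = inner_prod N g x"
  by (simp add: inner_prod_def)

lemma measurable_hypercube_coord:
  assumes "A \<in> M \<rightarrow>\<^sub>M count_space (hypercube N)"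
  shows "(\<lambda>z. A z i) \<in> borel_measurable M"
  by (rule measurable_compose[OF assms]) simp

text \<open>Once \<open>g\<close> and the seed are fixed, the output is a fixed point of the cube
  and only \<open>h\<close> is random, so the interval bound applies, uniformly in what was fixed.
  The \<open>max 0 r\<close> covers negative \<open>r\<close>, where the event is empty.\<close>

lemma prob_solution_set_correlated_le:
  assumes Q: "prob_space Q" and N: "N \<ge> 1" and q: "q > 0"
    and A[measurable]: "A \<in> (PiM {..<N} (\<lambda>_. borel) \<Otimes>\<^sub>M Q) \<rightarrow>\<^sub>M count_space (hypercube N)"
  shows "measure ((std_gaussian N \<Otimes>\<^sub>M std_gaussian N) \<Otimes>\<^sub>M Q)
           {z \<in> space ((std_gaussian N \<Otimes>\<^sub>M std_gaussian N) \<Otimes>\<^sub>M Q).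
             \<bar>inner_prod N (\<lambda>i. p * fst (fst z) i + q * snd (fst z) i) (A (fst (fst z), snd z))\<bar> \<le> r}
         \<le> 2 * max 0 r / (sqrt (2 * pi * real N) * q)"
    (is "measure ?M ?S \<le> ?b")
proof -
  let ?G = "std_gaussian N"
  interpret Q: prob_space Q by (rule Q)
  interpret G: prob_space ?G by (rule prob_space_std_gaussian)
  interpret GG: pair_prob_space ?G ?G ..
  interpret M: pair_prob_space "?G \<Otimes>\<^sub>M ?G" Q ..
  have b: "?b \<ge> 0" using q by simp
  note measurable_hypercube_coord[OF A, measurable]
  have S[measurable]: "?S \<in> sets ?M"
    unfolding inner_prod_def by measurable
  have inner: "emeasure ?G {h \<in> space ?G. \<bar>inner_prod N (\<lambda>i. p * g i + q * h i) (A (g, w))\<bar> \<le> r}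
      \<le> ennreal ?b" (is "emeasure _ ?T \<le> _")
    if "g \<in> space ?G" "w \<in> space Q" for g w
  proof (cases "r \<ge> 0")
    case True
    have "(g, w) \<in> space (PiM {..<N} (\<lambda>_. borel) \<Otimes>\<^sub>M Q)"
      using that sets_eq_imp_space_eq[OF sets_std_gaussian[of N]] by (simp add: space_pair_measure)
    then have x: "A (g, w) \<in> hypercube N"
      using measurable_space[OF A] by (simp add: space_count_space)
    \<comment> \<open>The contribution of \<open>g\<close> only shifts the interval for the inner
      product with \<open>h\<close>; its length stays \<open>2 * r / q\<close>.\<close>
    define c where "c = inner_prod N g (A (g, w))"
    have split: "inner_prod N (\<lambda>i. p * g i + q * h i) (A (g, w)) = p * c + q * inner_prod N h (A (g, w))" for h
      by (simp add: inner_prod_def c_def sum_distrib_left sum.distrib[symmetric] algebra_simps)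
    have "?T = {h \<in> space ?G. inner_prod N h (A (g, w)) \<in> {(- r - p * c) / q..(r - p * c) / q}}"
      unfolding split using q by (auto simp: field_simps abs_le_iff)
    then have "emeasure ?G ?T \<le> ennreal (((r - p * c) / q - (- r - p * c) / q) / (sqrt (2 * pi) * sqrt (real N)))"
      using G.normal_interval_le[OF inner_prod_hypercube_normal[OF x N]] N by simp
    also have "((r - p * c) / q - (- r - p * c) / q) / (sqrt (2 * pi) * sqrt (real N)) = ?b"
      using True q N by (simp add: real_sqrt_mult diff_divide_distrib[symmetric] divide_simps)
    finally show ?thesis .
  next
    case False
    then have "?T = {}" using order_trans[OF abs_ge_zero] by blast
    then show ?thesis by (simp only: emeasure_empty zero_le)
  qed
  \<comment> \<open>Fubini with the seed outermost and \<open>h\<close> innermost, so that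
    \<open>inner\<close> bounds each section.\<close>
  have "emeasure ?M ?S = (\<integral>\<^sup>+w. emeasure (?G \<Otimes>\<^sub>M ?G) ((\<lambda>x. (x, w)) -` ?S) \<partial>Q)"
    by (rule M.emeasure_pair_measure_alt2) (rule S)
  also have "\<dots> \<le> (\<integral>\<^sup>+w. ennreal ?b \<partial>Q)"
  proof (rule nn_integral_mono)
    fix w assume w: "w \<in> space Q"
    have "emeasure (?G \<Otimes>\<^sub>M ?G) ((\<lambda>x. (x, w)) -` ?S) = (\<integral>\<^sup>+g. emeasure ?G (Pair g -` ((\<lambda>x. (x, w)) -` ?S)) \<partial>?G)"
      by (intro G.emeasure_pair_measure_alt sets_Pair2[OF S])
    also have "\<dots> \<le> (\<integral>\<^sup>+g. ennreal ?b \<partial>?G)"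
    proof (rule nn_integral_mono)
      fix g assume g: "g \<in> space ?G"
      have "Pair g -` ((\<lambda>x. (x, w)) -` ?S) = {h \<in> space ?G. \<bar>inner_prod N (\<lambda>i. p * g i + q * h i) (A (g, w))\<bar> \<le> r}"
        using g w by (auto simp: space_pair_measure)
      then show "emeasure ?G (Pair g -` ((\<lambda>x. (x, w)) -` ?S)) \<le> ennreal ?b"
        using inner[OF g w] by simp
    qed
    also have "\<dots> = ennreal ?b" by (simp add: G.emeasure_space_1)
    finally show "emeasure (?G \<Otimes>\<^sub>M ?G) ((\<lambda>x. (x, w)) -` ?S) \<le> ennreal ?b" .
  qed
  also have "\<dots> = ennreal ?b" by (simp add: Q.emeasure_space_1)
  finally show ?thesis
    using b by (simp add: M.P.emeasure_eq_measure)
qed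

section \<open>Separation of the cube and the estimate in a fixed dimension\<close>

lemma hypercube_dist_ge_2:
  assumes x: "x \<in> hypercube N" and y: "y \<in> hypercube N" and "x \<noteq> y"
  shows "euclid_norm N (\<lambda>i. x i - y i) \<ge> 2"
proof -
  have "\<exists>i<N. x i \<noteq> y i"
  proof (rule ccontr)
    assume eq: "\<not> ?thesis"
    have "x = y"
      by (rule PiE_ext[OF x[unfolded hypercube_def] y[unfolded hypercube_def]]) (use eq in simp)
    with \<open>x \<noteq> y\<close> show False by simp
  qed
  then obtain i where i: "i < N" "x i \<noteq> y i" by blast
  have "x i = -1 \<or> x i = 1" 
    using PiE_mem[OF x[unfolded hypercube_def], of i] i(1) by simp
  moreover have "y i = -1 \<or> y i = 1"
    using PiE_mem[OF y[unfolded hypercube_def], of i] i(1) by simp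
  \<comment> \<open>Different signs differ by 2 in absolute value, so this single coordinate already
    gives the required distance.\<close>
  ultimately have "2\<^sup>2 \<le> (x i - y i)\<^sup>2"
    using i(2) by (elim disjE) simp_all
  moreover have "(x i - y i)\<^sup>2 \<le> (\<Sum>i<N. (x i - y i)\<^sup>2)"
    using i(1) by (intro member_le_sum[of i "{..<N}" "\<lambda>i. (x i - y i)\<^sup>2"]) simp_all
  ultimately show ?thesis
    unfolding euclid_norm_def L2_set_def by (intro real_le_rsqrt) simp
qed


text \<open>All events are placed on one space of triples \<open>((g, h), w)\<close>, with
  \<open>F (g, h)\<close> as the correlated instance; a union bound then joins stability with
  anticoncentration.\<close>

lemma prob_solve_le:
  assumes alg: "randomized_algorithm N T Q A" and stable: "stable_with_degree N C D Q A"
    and N: "N \<ge> 1" and \<epsilon>: "0 < \<epsilon>" "\<epsilon> < 1"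
  shows "\<P>((g, w) in std_gaussian N \<Otimes>\<^sub>M Q. A (g, w) \<in> solution_set N E g)
    \<le> C * D * \<epsilon> * real N / 2 + 2 * 2 powr (- E) / (sqrt (2 * pi * real N) * sqrt (1 - (1 - \<epsilon>)\<^sup>2))"
proof -
  let ?G = "std_gaussian N" and ?B = "PiM {..<N} (\<lambda>_. borel) :: (nat \<Rightarrow> real) measure"
  let ?M = "(?G \<Otimes>\<^sub>M ?G) \<Otimes>\<^sub>M Q"
  have A[measurable]: "A \<in> (?B \<Otimes>\<^sub>M Q) \<rightarrow>\<^sub>M count_space (hypercube N)"
    and Q: "prob_space Q"
    using alg by (auto simp: randomized_algorithm_def polish_law_def)
  note measurable_hypercube_coord[OF A, measurable]
  interpret Q: prob_space Q by (rule Q)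
  interpret G: prob_space ?G by (rule prob_space_std_gaussian)
  interpret GG: pair_prob_space ?G ?G ..
  interpret M: pair_prob_space "?G \<Otimes>\<^sub>M ?G" Q ..
  \<comment> \<open>\<open>pair_measure_distr\<close> pushes both factors forward; the seed is
    pushed by the identity.\<close>
  have Q_id: "distr Q Q (\<lambda>w. w) = Q" by simp
  have Q_sigma: "sigma_finite_measure (distr Q Q (\<lambda>w. w))"
    unfolding Q_id by (rule Q.sigma_finite_measure_axioms)
  define p q where "p = 1 - \<epsilon>" and "q = sqrt (1 - p\<^sup>2)"
  have p: "0 < p" "p < 1" using \<epsilon> by (simp_all add: p_def)
  then have "p\<^sup>2 < 1" by (simp add: power_less_one_iff)
  with p have pq: "p > 0" "q > 0" "p\<^sup>2 + q\<^sup>2 = 1"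
    by (simp_all add: q_def)
  define F where "F = (\<lambda>(g, h). \<lambda>i\<in>{..<N}. p * g i + q * h i :: real)"
  have F[measurable]: "F \<in> ?G \<Otimes>\<^sub>M ?G \<rightarrow>\<^sub>M ?B"
    unfolding F_def by measurable
  have B_space: "space ?B = space ?G"
    by (rule sets_eq_imp_space_eq[symmetric]) (rule sets_std_gaussian)
  have cube: "A (g, w) \<in> hypercube N" if "g \<in> space ?G" "w \<in> space Q" for g w
    using measurable_space[OF A, of "(g, w)"] that by (simp add: space_pair_measure B_space)
  have F_space: "F z \<in> space ?G" if "z \<in> space (?G \<Otimes>\<^sub>M ?G)" for z
    using measurable_space[OF F that] by (simp add: B_space)

  \<comment> \<open>The correlated instance with the seed has the law of the original instance with
    the seed, so success may be measured at \<open>F (g, h)\<close>.\<close>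
  have GQ: "?G \<Otimes>\<^sub>M Q = distr ?M (?B \<Otimes>\<^sub>M Q) (\<lambda>(z, w). (F z, w))"
    using pair_measure_distr[OF F measurable_ident_sets[OF refl] Q_sigma]
    by (simp add: F_def std_gaussian_rotate[OF pq])
  have CQ: "correlated_gaussian_pair N p \<Otimes>\<^sub>M Q =
      distr ?M ((?B \<Otimes>\<^sub>M ?B) \<Otimes>\<^sub>M Q) (\<lambda>(z, w). ((fst z, F z), w))"
  proof -
    have F': "(\<lambda>z. (fst z, F z)) \<in> ?G \<Otimes>\<^sub>M ?G \<rightarrow>\<^sub>M ?B \<Otimes>\<^sub>M ?B" by measurable
    have "correlated_gaussian_pair N p = distr (?G \<Otimes>\<^sub>M ?G) (?B \<Otimes>\<^sub>M ?B) (\<lambda>z. (fst z, F z))"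
      unfolding correlated_gaussian_pair_def F_def q_def by (simp add: case_prod_unfold)
    then show ?thesis
      using pair_measure_distr[OF F' measurable_ident_sets[OF refl] Q_sigma] by simp
  qed

  \<comment> \<open>\<open>S\<close>: success on the correlated instance. \<open>S1\<close>: the two
    outputs are at distance at least 2. \<open>S2\<close>: the output for the original instance
    solves the correlated one.\<close>
  define S where "S = {z \<in> space ?M.
      \<bar>inner_prod N (F (fst z)) (A (F (fst z), snd z))\<bar> \<le> 2 powr (- E)}"
  define S1 where "S1 = {z \<in> space ?M.
      2 \<le> euclid_norm N (\<lambda>i. A (fst (fst z), snd z) i - A (F (fst z), snd z) i)}"
  define S2 where "S2 = {z \<in> space ?M.
      \<bar>inner_prod N (\<lambda>i. p * fst (fst z) i + q * snd (fst z) i) (A (fst (fst z), snd z))\<bar> \<le> 2 powr (- E)}"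
  have S1: "S1 \<in> sets ?M"
    unfolding S1_def euclid_norm_def L2_set_def by measurable
  have S2: "S2 \<in> sets ?M"
    unfolding S2_def inner_prod_def by measurable
  have solve: "\<P>((g, w) in ?G \<Otimes>\<^sub>M Q. A (g, w) \<in> solution_set N E g) = measure ?M S"
  proof -
    let ?S = "{z \<in> space (?B \<Otimes>\<^sub>M Q). \<bar>inner_prod N (fst z) (A z)\<bar> \<le> 2 powr (- E)}"
    have meas: "?S \<in> sets (?B \<Otimes>\<^sub>M Q)"
      unfolding inner_prod_def by measurable
    \<comment> \<open>Outputs always lie in the cube, so only the inner product condition
      remains.\<close>
    have "{(g, w) \<in> space (?G \<Otimes>\<^sub>M Q). A (g, w) \<in> solution_set N E g} = ?S"
      using cube by (auto simp: solution_set_def space_pair_measure B_space)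
    then have "\<P>((g, w) in ?G \<Otimes>\<^sub>M Q. A (g, w) \<in> solution_set N E g)
        = measure (distr ?M (?B \<Otimes>\<^sub>M Q) (\<lambda>(z, w). (F z, w))) ?S"
      unfolding GQ[symmetric] by (rule arg_cong)
    also have "\<dots> = measure ?M ((\<lambda>(z, w). (F z, w)) -` ?S \<inter> space ?M)"
      by (rule measure_distr[OF _ meas]) measurable
    also have "(\<lambda>(z, w). (F z, w)) -` ?S \<inter> space ?M = S"
      using F_space by (auto simp: S_def space_pair_measure B_space)
    finally show ?thesis .
  qed
  have disagree: "measure ?M S1 \<le> C * D * \<epsilon> * real N / 2"
  proof -
    let ?S = "{z \<in> space ((?B \<Otimes>\<^sub>M ?B) \<Otimes>\<^sub>M Q).
      2 \<le> euclid_norm N (\<lambda>i. A (fst (fst z), snd z) i - A (snd (fst z), snd z) i)}"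
    have meas: "?S \<in> sets ((?B \<Otimes>\<^sub>M ?B) \<Otimes>\<^sub>M Q)"
      unfolding euclid_norm_def L2_set_def by measurable
    have "S1 = (\<lambda>(z, w). ((fst z, F z), w)) -` ?S \<inter> space ?M"
      using F_space by (auto simp: S1_def space_pair_measure B_space)
    moreover have "(\<lambda>(z, w). ((fst z, F z), w)) \<in> ?M \<rightarrow>\<^sub>M (?B \<Otimes>\<^sub>M ?B) \<Otimes>\<^sub>M Q"
      by measurable
    ultimately have "measure ?M S1 = measure (correlated_gaussian_pair N p \<Otimes>\<^sub>M Q) ?S"
      unfolding CQ by (simp only: measure_distr meas)
    \<comment> \<open>The threshold 2 is written as \<open>2 * sqrt (\<eta> * real N)\<close> with
      \<open>\<eta> = 1 / real N\<close>, to match the stability hypothesis.\<close>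
    also have "?S = {((g, g'), w) \<in> space (correlated_gaussian_pair N p \<Otimes>\<^sub>M Q).
        2 * sqrt (1 / real N * real N) \<le> euclid_norm N (\<lambda>i. A (g, w) i - A (g', w) i)}"
      using N by (simp add: CQ case_prod_unfold)
    also have "measure (correlated_gaussian_pair N p \<Otimes>\<^sub>M Q) \<dots> \<le> C * D * \<epsilon> / (2 * (1 / real N))"
      unfolding p_def
      by (rule stable[unfolded stable_with_degree_def, rule_format]) (use N \<epsilon> in auto)
    finally show ?thesis by simp
  qed
  have "S \<subseteq> S1 \<union> S2"
  proof
    fix z assume z: "z \<in> S"
    show "z \<in> S1 \<union> S2"
    proof (cases "A (fst (fst z), snd z) = A (F (fst z), snd z)")
      case True
      have "inner_prod N (F (fst z)) x = inner_prod N (\<lambda>i. p * fst (fst z) i + q * snd (fst z) i) x" for x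
        by (simp add: F_def case_prod_unfold)
      with z True have "z \<in> S2" by (simp add: S_def S2_def)
      then show ?thesis ..
    next
      case False
      have sp: "fst z \<in> space (?G \<Otimes>\<^sub>M ?G)" "snd z \<in> space Q" "fst (fst z) \<in> space ?G"
        using z by (auto simp: S_def space_pair_measure)
      have "2 \<le> euclid_norm N (\<lambda>i. A (fst (fst z), snd z) i - A (F (fst z), snd z) i)"
        by (intro hypercube_dist_ge_2 cube F_space sp False)
      with z have "z \<in> S1" by (simp add: S_def S1_def)
      then show ?thesis ..
    qed
  qed
  then have "measure ?M S \<le> measure ?M (S1 \<union> S2)"
    by (intro M.P.finite_measure_mono sets.Un S1 S2)
  also have "\<dots> \<le> measure ?M S1 + measure ?M S2"
    by (rule measure_Un_le) (rule S1 S2)+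
  also have "\<dots> \<le> C * D * \<epsilon> * real N / 2 + 2 * 2 powr (- E) / (sqrt (2 * pi * real N) * q)"
    using prob_solution_set_correlated_le[OF Q N pq(2) A, of p "2 powr (- E)"] disagree
    by (simp add: S2_def)
  finally show ?thesis
    unfolding solve by (simp add: q_def p_def)
qed

section \<open>Choice of the correlation and passage to the limit\<close>

theorem theorem1p3:
  fixes C :: real
    and E D :: "nat \<Rightarrow> real"
    and \<Omega> :: "nat \<Rightarrow> 'w topology"
    and Q :: "nat \<Rightarrow> 'w measure"
    and A :: "nat \<Rightarrow> (nat \<Rightarrow> real) \<times> 'w \<Rightarrow> (nat \<Rightarrow> real)"
  assumes "C > 0"
    and "\<And>N. N \<ge> 1 \<Longrightarrow> randomized_algorithm N (\<Omega> N) (Q N) (A N)"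
    and "\<And>N. N \<ge> 1 \<Longrightarrow>
           (LINT z|(std_gaussian N \<Otimes>\<^sub>M Q N). (euclid_norm N (A N z))\<^sup>2) \<le> C * real N"
    and "\<And>N. N \<ge> 1 \<Longrightarrow> D N \<ge> 0"
    and "\<And>N. N \<ge> 1 \<Longrightarrow> stable_with_degree N C (D N) (Q N) (A N)"
    and "filterlim (\<lambda>N. E N / ln (real N)) at_top sequentially"
    and "\<And>N. N \<ge> 1 \<Longrightarrow> E N \<le> real N"
    and "D \<in> o(\<lambda>N. 2 powr (E N / 4))"
  shows "(\<lambda>N. \<P>((g, w) in std_gaussian N \<Otimes>\<^sub>M Q N. A N (g, w) \<in> solution_set N (E N) g))
           \<in> o(\<lambda>_. 1)"
proof -
  let ?P = "\<lambda>N. \<P>((g, w) in std_gaussian N \<Otimes>\<^sub>M Q N. A N (g, w) \<in> solution_set N (E N) g)"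
  \<comment> \<open>The value of the two error terms when
    \<open>\<epsilon> * N = 2 powr (- E / 4)\<close>. The second loses the square root
    \<open>2 powr (- E / 8)\<close> from its denominator, whence 7/8.\<close>
  let ?b = "\<lambda>N. C / 2 * (D N / 2 powr (E N / 4)) + 2 powr (- (7 / 8) * E N)"
  \<comment> \<open>Eventually the ratio is at least 1; \<open>N \<ge> 2\<close> makes the logarithm
    positive.\<close>
  have E_ge: "\<forall>\<^sub>F N in sequentially. ln (real N) \<le> E N"
    using assms(6)[unfolded filterlim_at_top, rule_format, of 1] eventually_ge_at_top[of 2]
    by eventually_elim (simp add: field_simps)
  have E_top: "filterlim E at_top sequentially"
    by (rule filterlim_at_top_mono[OF _ E_ge]) real_asymp
  have bound: "\<forall>\<^sub>F N in sequentially. ?P N \<le> ?b N"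
    using filterlim_at_top_dense[THEN iffD1, OF E_top, rule_format, of 0] eventually_ge_at_top[of 1]
  proof eventually_elim
    case (elim N)
    define \<epsilon> where "\<epsilon> = 2 powr (- (E N / 4)) / real N"
    have "2 powr (- (E N / 4)) < 2 powr (0 :: real)"
      using elim by (intro powr_less_mono) auto
    then have \<epsilon>: "0 < \<epsilon>" "\<epsilon> < 1"
      using elim by (auto simp: \<epsilon>_def divide_simps)
    \<comment> \<open>This bounds the variance factor \<open>1 - (1 - \<epsilon>)\<^sup>2 = 2 *
      \<epsilon> - \<epsilon>\<^sup>2\<close> below by \<open>\<epsilon>\<close>.\<close>
    have "\<epsilon>\<^sup>2 \<le> \<epsilon>" using \<epsilon> by (simp add: power2_eq_square mult_le_cancel_left1)
    then have "\<epsilon> \<le> 1 - (1 - \<epsilon>)\<^sup>2" by (simp add: power2_eq_square algebra_simps)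
    \<comment> \<open>The crude bound of \<open>2 * pi\<close> below by 4 leaves a factor 2 after
      the square root, which cancels the 2 in the numerator.\<close>
    then have "2\<^sup>2 * (real N * \<epsilon>) \<le> (2 * pi * real N) * (1 - (1 - \<epsilon>)\<^sup>2)"
      using \<epsilon> pi_gt3 by (subst mult.assoc[symmetric], intro mult_mono) auto
    then have "sqrt (2\<^sup>2 * (real N * \<epsilon>)) \<le> sqrt (2 * pi * real N) * sqrt (1 - (1 - \<epsilon>)\<^sup>2)"
      unfolding real_sqrt_mult[symmetric] by (rule real_sqrt_le_mono)
    moreover have "real N * \<epsilon> = 2 powr (- (E N / 4))"
      using elim by (simp add: \<epsilon>_def)
    moreover have "sqrt (2 powr (- (E N / 4))) = 2 powr (- (E N / 8))"
      by (simp add: powr_half_sqrt[symmetric] powr_powr)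
    ultimately have le: "2 * 2 powr (- (E N / 8)) \<le> sqrt (2 * pi * real N) * sqrt (1 - (1 - \<epsilon>)\<^sup>2)"
      by (simp add: real_sqrt_mult)
    have "?P N \<le> C * D N * \<epsilon> * real N / 2
        + 2 * 2 powr (- E N) / (sqrt (2 * pi * real N) * sqrt (1 - (1 - \<epsilon>)\<^sup>2))"
      using elim by (intro prob_solve_le[OF assms(2,5) _ \<epsilon>]) auto
    also have "2 * 2 powr (- E N) / (sqrt (2 * pi * real N) * sqrt (1 - (1 - \<epsilon>)\<^sup>2))
        \<le> 2 * 2 powr (- E N) / (2 * 2 powr (- (E N / 8)))"
      by (intro divide_left_mono le mult_pos_pos less_le_trans[OF _ le]) auto
    also have "\<dots> = 2 powr (- (7 / 8) * E N)"
      by (simp add: powr_diff[symmetric])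
    also have "C * D N * \<epsilon> * real N / 2 = C / 2 * (D N / 2 powr (E N / 4))"
      using elim by (simp add: \<epsilon>_def powr_minus field_simps)
    finally show ?case by simp
  qed
  have "(\<lambda>N. D N / 2 powr (E N / 4)) \<longlonglongrightarrow> 0"
    by (rule smalloD_tendsto[OF assms(8)])
  moreover have "(\<lambda>N. 2 powr (- (7 / 8) * E N)) \<longlonglongrightarrow> 0"
  proof -
    have "((\<lambda>x :: real. 2 powr (- (7 / 8) * x)) \<longlongrightarrow> 0) at_top" by real_asymp
    from filterlim_compose[OF this E_top] show ?thesis .
  qed
  ultimately have "?b \<longlonglongrightarrow> C / 2 * 0 + 0"
    by (intro tendsto_intros)
  then have "?b \<longlonglongrightarrow> 0" by simp
  have "?P \<longlonglongrightarrow> 0"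
    by (rule tendsto_sandwich[OF _ bound tendsto_const \<open>?b \<longlonglongrightarrow> 0\<close>]) simp
  then show ?thesis
    by (intro smalloI_tendsto) auto
qed

end
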